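(* Let $A^\ast_{n,\le m}$, $A^\ast_{n,\ge m}$, $\xi_n$, $\alpha_j$ be taken from any one of the four families (Bernoulli, Cauchy, Euler, Euler of the second kind) described in the context, with the corresponding integer parameter $N$, and let $m\ge1$. For a sequence $d_1,d_2,\dots$ write $$\Delta_n(d_1,\dots,d_n)=\begin{vmatrix} d_1&1&&&\\ d_2&d_1&&&\\ \vdots&\vdots&\ddots&1&\\ d_{n-1}&d_{n-2}&\cdots&d_1&1\\ d_n&d_{n-1}&\cdots&d_2&d_1\end{vmatrix},$$ i.e. the determinant of the $n\times n$ matrix whose $(i,j)$ entry is $d_{i-j+1}$ if $i\ge j$, $1$ if $j=i+1$, and $0$ if $j>i+1$. For $n\ge1$, we have $$\Delta_n\left(\frac{A_{1,\le m}^\ast}{\xi_1},\dots,\frac{A_{n,\le m}^\ast}{\xi_n}\right)=\begin{cases}\alpha_n&(n\le m)\\ 0&(n>m)\end{cases}$$ and $$\Delta_n\left(\frac{A_{1,\ge m}^\ast}{\xi_1},\dots,\frac{A_{n,\ge m}^\ast}{\xi_n}\right)=\begin{cases}0&(n<m)\\ \alpha_n&(n\ge m).\end{cases}$$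
   Context: $(x)^{(n)}=x(x+1)\cdots(x+n-1)$ for $n\ge1$ and $(x)^{(0)}=1$ (rising factorial). All identities below are between formal power series in $x$. For an integer $m\ge 1$ define the modified restricted and modified associated hypergeometric numbers by: - Bernoulli ($N\ge1$): $\left(\sum_{n=0}^{m}\frac{x^n}{(N+1)^{(n)}}\right)^{-1}=\sum_{n=0}^\infty B_{N,n,\le m}^\ast\frac{x^n}{n!}$ and $\left(1+\sum_{n=m}^{\infty}\frac{x^n}{(N+1)^{(n)}}\right)^{-1}=\sum_{n=0}^\infty B_{N,n,\ge m}^\ast\frac{x^n}{n!}$; - Cauchy ($N\ge1$): $\left(N\sum_{n=0}^{m}\frac{(-x)^n}{N+n}\right)^{-1}=\sum_{n=0}^\infty c_{N,n,\le m}^\ast\frac{x^n}{n!}$ and $\left(1+N\sum_{n=m}^{\infty}\frac{(-x)^n}{N+n}\right)^{-1}=\sum_{n=0}^\infty c_{N,n,\ge m}^\ast\frac{x^n}{n!}$; - Euler ($N\ge0$): $\left(\sum_{n=0}^{m}\frac{x^{2n}}{(2N+1)^{(2n)}}\right)^{-1}=\sum_{n=0}^\infty E_{N,n,\le m}^\ast\frac{x^n}{n!}$ and $\left(1+\sum_{n=m}^{\infty}\frac{x^{2n}}{(2N+1)^{(2n)}}\right)^{-1}=\sum_{n=0}^\infty E_{N,n,\ge m}^\ast\frac{x^n}{n!}$; - Euler of the second kind ($N\ge0$): $\left(\sum_{n=0}^{m}\frac{x^{2n}}{(2N+2)^{(2n)}}\right)^{-1}=\sum_{n=0}^\infty\widehat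 E_{N,n,\le m}^\ast\frac{x^n}{n!}$ and $\left(1+\sum_{n=m}^{\infty}\frac{x^{2n}}{(2N+2)^{(2n)}}\right)^{-1}=\sum_{n=0}^\infty\widehat E_{N,n,\ge m}^\ast\frac{x^n}{n!}$. The symbols $A^\ast_{n,\le m}$, $A^\ast_{n,\ge m}$, $\xi_n$ ($n\ge0$), $\alpha_j$ ($j\ge1$) denote simultaneously one of the following choices ($N$ is suppressed from the notation): - Bernoulli: $A^\ast_{n,\le m}=B^\ast_{N,n,\le m}$, $A^\ast_{n,\ge m}=B^\ast_{N,n,\ge m}$, $\xi_n=(-1)^n n!$, $\alpha_j=\frac{N!}{(N+j)!}$, $N\ge1$; - Cauchy: $A^\ast_{n,\le m}=c^\ast_{N,n,\le m}$, $A^\ast_{n,\ge m}=c^\ast_{N,n,\ge m}$, $\xi_n=n!$, $\alpha_j=\frac{N}{N+j}$, $N\ge1$; - Euler: $A^\ast_{n,\le m}=E^\ast_{N,2n,\le m}$, $A^\ast_{n,\ge m}=E^\ast_{N,2n,\ge m}$, $\xi_n=(-1)^n(2n)!$, $\alpha_j=\frac{(2N)!}{(2N+2j)!}$, $N\ge0$; - Euler of the second kind: $A^\ast_{n,\le m}=\widehat E^\ast_{N,2n,\le m}$, $A^\ast_{n,\ge m}=\widehat E^\ast_{N,2n,\ge m}$, $\xi_n=(-1)^n(2n)!$, $\alpha_j=\frac{(2N+1)!}{(2N+2j+1)!}$, $N\ge0$. *)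

theory Defs
  imports "HOL-Computational_Algebra.Formal_Power_Series" "Jordan_Normal_Form.Determinant"
begin

text \<open>
  The rising factorial is \<^const>\<open>pochhammer\<close>.  Every power series inverted below has constant
  coefficient 1 (for \<open>m \<ge> 1\<close>, and \<open>N \<ge> 1\<close> in the Cauchy case), so \<^const>\<open>inverse\<close> is the genuine
  multiplicative inverse.
\<close>

text \<open>The numbers \<open>a n\<close> with \<open>F = (\<Sum>n. a n * x ^ n / n!)\<close>.\<close>

definition egf_coeff :: "rat fps \<Rightarrow> nat \<Rightarrow> rat" where
  "egf_coeff F n = fact n * fps_nth F n"

lemma egf_coeff_unique: "F = Abs_fps (\<lambda>n. a n / fact n) \<longleftrightarrow> a = egf_coeff F"
  by (auto simp: fps_eq_iff egf_coeff_def fun_eq_iff field_simps)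

definition bernoulli_le :: "nat \<Rightarrow> nat \<Rightarrow> nat \<Rightarrow> rat" where
  "bernoulli_le N m = egf_coeff (inverse
     (\<Sum>n=0..m. fps_const (1 / pochhammer (of_nat N + 1) n) * fps_X ^ n))"

definition bernoulli_ge :: "nat \<Rightarrow> nat \<Rightarrow> nat \<Rightarrow> rat" where
  "bernoulli_ge N m = egf_coeff (inverse
     (1 + Abs_fps (\<lambda>n. if m \<le> n then 1 / pochhammer (of_nat N + 1) n else 0)))"

definition cauchy_le :: "nat \<Rightarrow> nat \<Rightarrow> nat \<Rightarrow> rat" where
  "cauchy_le N m = egf_coeff (inverse
     (fps_const (of_nat N) * (\<Sum>n=0..m. fps_const (1 / of_nat (N + n)) * (- fps_X) ^ n)))"

definition cauchy_ge :: "nat \<Rightarrow> nat \<Rightarrow> nat \<Rightarrow> rat" where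
  "cauchy_ge N m = egf_coeff (inverse
     (1 + fps_const (of_nat N) * Abs_fps (\<lambda>n. if m \<le> n then (- 1) ^ n / of_nat (N + n) else 0)))"

text \<open>In the infinite even series below, the index \<open>k\<close> stands for \<open>2n\<close>.\<close>

definition euler_le :: "nat \<Rightarrow> nat \<Rightarrow> nat \<Rightarrow> rat" where
  "euler_le N m = egf_coeff (inverse
     (\<Sum>n=0..m. fps_const (1 / pochhammer (2 * of_nat N + 1) (2 * n)) * fps_X ^ (2 * n)))"

definition euler_ge :: "nat \<Rightarrow> nat \<Rightarrow> nat \<Rightarrow> rat" where
  "euler_ge N m = egf_coeff (inverse
     (1 + Abs_fps (\<lambda>k. if even k \<and> 2 * m \<le> k then 1 / pochhammer (2 * of_nat N + 1) k else 0)))"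

definition euler2_le :: "nat \<Rightarrow> nat \<Rightarrow> nat \<Rightarrow> rat" where
  "euler2_le N m = egf_coeff (inverse
     (\<Sum>n=0..m. fps_const (1 / pochhammer (2 * of_nat N + 2) (2 * n)) * fps_X ^ (2 * n)))"

definition euler2_ge :: "nat \<Rightarrow> nat \<Rightarrow> nat \<Rightarrow> rat" where
  "euler2_ge N m = egf_coeff (inverse
     (1 + Abs_fps (\<lambda>k. if even k \<and> 2 * m \<le> k then 1 / pochhammer (2 * of_nat N + 2) k else 0)))"

datatype family = Bernoulli | Cauchy | Euler | Euler2

fun admissible :: "family \<Rightarrow> nat \<Rightarrow> bool" where
  "admissible Bernoulli N \<longleftrightarrow> N \<ge> 1"
| "admissible Cauchy N \<longleftrightarrow> N \<ge> 1"
| "admissible Euler N \<longleftrightarrow> True"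
| "admissible Euler2 N \<longleftrightarrow> True"

fun A_le :: "family \<Rightarrow> nat \<Rightarrow> nat \<Rightarrow> nat \<Rightarrow> rat" where
  "A_le Bernoulli N m n = bernoulli_le N m n"
| "A_le Cauchy N m n = cauchy_le N m n"
| "A_le Euler N m n = euler_le N m (2 * n)"
| "A_le Euler2 N m n = euler2_le N m (2 * n)"

fun A_ge :: "family \<Rightarrow> nat \<Rightarrow> nat \<Rightarrow> nat \<Rightarrow> rat" where
  "A_ge Bernoulli N m n = bernoulli_ge N m n"
| "A_ge Cauchy N m n = cauchy_ge N m n"
| "A_ge Euler N m n = euler_ge N m (2 * n)"
| "A_ge Euler2 N m n = euler2_ge N m (2 * n)"

fun \<xi> :: "family \<Rightarrow> nat \<Rightarrow> rat" where
  "\<xi> Bernoulli n = (- 1) ^ n * fact n"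
| "\<xi> Cauchy n = fact n"
| "\<xi> Euler n = (- 1) ^ n * fact (2 * n)"
| "\<xi> Euler2 n = (- 1) ^ n * fact (2 * n)"

fun \<alpha> :: "family \<Rightarrow> nat \<Rightarrow> nat \<Rightarrow> rat" where
  "\<alpha> Bernoulli N j = fact N / fact (N + j)"
| "\<alpha> Cauchy N j = of_nat N / of_nat (N + j)"
| "\<alpha> Euler N j = fact (2 * N) / fact (2 * N + 2 * j)"
| "\<alpha> Euler2 N j = fact (2 * N + 1) / fact (2 * N + 2 * j + 1)"

text \<open>Matrix indices start at 0 here; only \<open>d 1, \<dots>, d n\<close> occur.\<close>

definition \<Delta> :: "nat \<Rightarrow> (nat \<Rightarrow> rat) \<Rightarrow> rat" where
  "\<Delta> n d = det (mat n n
     (\<lambda>(i, j). if j \<le> i then d (i - j + 1) else if j = i + 1 then 1 else 0))"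

end

theory Submission
  imports Defs
begin

text \<open>
  All identities are instances of the inversion formula for lower triangular Toeplitz systems:
  the determinants \<^term>\<open>\<Delta> n d\<close> recover, up to signs, the coefficients of a power series from
  those of its reciprocal.  Suppose \<open>a 0 = d 0 = 1\<close> and let \<open>a\<close> and \<open>d\<close> satisfy the
  convolution identities \<open>(\<Sum>j\<le>k. (- 1) ^ j * a j * d (k - j)) = 0\<close> for \<open>k \<ge> 1\<close>, which say that
  \<open>\<Sum>j. a j * (- x) ^ j\<close> and \<open>\<Sum>j. d j * x ^ j\<close> are reciprocal to each other.  Add to the first
  column of the matrix of \<^term>\<open>\<Delta> n d\<close> the combination of the other columns with coefficients
  \<open>(- 1) ^ j * a j\<close>.  The identities for \<open>k < n\<close> annihilate all its entries but the last, the
  identity for \<open>k = n\<close> makes the last one \<open>(- 1) ^ (n - 1) * a n\<close>, and its minor is unitriangular.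
  Hence \<open>\<Delta> n d = a n\<close> (lemma \<open>Delta_eq_of_convolution\<close>).

  In each family the numbers \<open>A\<^sub>k\<^sup>* / \<xi>\<^sub>k\<close> are, up to the sign \<open>(- 1) ^ k\<close> or no sign at all, the
  coefficients of the reciprocal of a series \<open>g\<close>, read off at all exponents (Bernoulli, Cauchy) or
  at the even ones (both Euler families).  Reading only even exponents preserves the
  convolution identities because there \<open>g\<close> is an even series
  (lemma \<open>Delta_inverse_section\<close>).  So the determinant is the \<open>n\<close>-th, respectively \<open>2n\<close>-th,
  coefficient of \<open>g\<close> up to sign; this coefficient is \<open>\<plusminus>\<alpha>\<^sub>n\<close> where the truncation keeps
  it and \<open>0\<close> where it drops it.
\<close>

section \<open>The Toeplitz--Hessenberg determinant\<close>

text \<open>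
  The value \<open>d 0 = 1\<close> makes the ones above the diagonal continue the Toeplitz pattern, so that
  row \<open>i\<close> pairs with the vector of the \<open>(- 1) ^ j * a j\<close> to the convolution for \<open>k = i + 1\<close>,
  which is complete in every row but the last.
\<close>

lemma Delta_eq_of_convolution:
  fixes a d :: "nat \<Rightarrow> rat"
  assumes a0: "a 0 = 1" and d0: "d 0 = 1"
    and conv: "\<And>k. k \<ge> 1 \<Longrightarrow> (\<Sum>j\<le>k. (- 1) ^ j * a j * d (k - j)) = 0"
  shows "\<Delta> n d = a n"
proof (cases n)
  case 0
  then show ?thesis by (simp add: \<Delta>_def a0)
next
  case (Suc l)
  define M where "M = mat n n
     (\<lambda>(i, j). if j \<le> i then d (i - j + 1) else if j = i + 1 then 1 else 0)"
  \<comment> \<open>Multiplication by \<open>U\<close> on the right is the column operation on the first column.\<close>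
  define U where "U = mat n n
     (\<lambda>(i, j). if j = 0 then (- 1) ^ i * a i else if i = j then 1 else 0)"
  have M: "M \<in> carrier_mat n n" and U: "U \<in> carrier_mat n n"
    by (auto simp: M_def U_def)
  have MU: "M * U \<in> carrier_mat n n" using M U by simp
  have "det U = prod_list (diag_mat U)"
    by (rule det_lower_triangular[OF _ U]) (auto simp: U_def)
  also have "\<dots> = 1"
    by (auto simp: prod_list_diag_prod U_def a0 intro!: prod.neutral)
  finally have detU: "det U = 1" .

  have col0: "(M * U) $$ (i, 0) = (if i = l then (- 1) ^ l * a n else 0)" if "i < n" for i
  proof -
    have "(M * U) $$ (i, 0) = (\<Sum>j<n. M $$ (i, j) * U $$ (j, 0))"
      using that M U by (simp add: scalar_prod_def atLeast0LessThan)
    also have "\<dots> = (\<Sum>j<n. if j \<le> i + 1 then (- 1) ^ j * a j * d (i + 1 - j) else 0)"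
    proof (rule sum.cong)
      fix j assume "j \<in> {..<n}"
      then show "M $$ (i, j) * U $$ (j, 0) =
          (if j \<le> i + 1 then (- 1) ^ j * a j * d (i + 1 - j) else 0)"
        using that by (auto simp: M_def U_def d0 Suc_diff_le le_Suc_eq)
    qed simp
    also have "\<dots> = (\<Sum>j \<in> {..<n} \<inter> {..i + 1}. (- 1) ^ j * a j * d (i + 1 - j))"
      by (simp only: sum.inter_restrict finite_lessThan atMost_iff)
    also have "\<dots> = (if i = l then (- 1) ^ l * a n else 0)"
    proof (cases "i = l")
      case True
      \<comment> \<open>The row has no column \<open>n\<close>, so the last term of the convolution is left over.\<close>
      have "{..<n} \<inter> {..i + 1} = {..l}" using True Suc by auto
      moreover have "(\<Sum>j\<le>Suc l. (- 1) ^ j * a j * d (Suc l - j)) = 0"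
        by (rule conv) simp
      ultimately show ?thesis using True Suc by (simp add: d0)
    next
      case False
      then have "{..<n} \<inter> {..i + 1} = {..i + 1}" using that Suc by auto
      with False show ?thesis using conv[of "i + 1"] by simp
    qed
    finally show ?thesis .
  qed

  define D where "D = mat_delete (M * U) l 0"
  have D: "D \<in> carrier_mat l l"
    unfolding D_def using mat_delete_carrier[OF MU] Suc by simp
  have D_entry: "D $$ (i, j) = M $$ (i, j + 1)" if "i < l" "j < l" for i j
  proof -
    have "D $$ (i, j) = (M * U) $$ (i, j + 1)"
      using that M U Suc by (simp add: D_def mat_delete_def)
    also have "\<dots> = (\<Sum>k<n. M $$ (i, k) * U $$ (k, j + 1))"
      using that M U Suc by (simp add: scalar_prod_def atLeast0LessThan)
    also have "\<dots> = (\<Sum>k<n. if k = j + 1 then M $$ (i, k) else 0)"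
      using that Suc by (intro sum.cong) (auto simp: U_def)
    also have "\<dots> = M $$ (i, j + 1)" using that Suc by simp
    finally show ?thesis .
  qed
  have "det D = prod_list (diag_mat D)"
    by (rule det_lower_triangular[OF _ D]) (use Suc in \<open>auto simp: D_entry M_def\<close>)
  also have "\<dots> = 1"
    using D Suc by (auto simp: prod_list_diag_prod D_entry M_def intro!: prod.neutral)
  finally have detD: "det D = 1" .

  have "\<Delta> n d = det (M * U)"
    using det_mult[OF M U] detU by (simp add: \<Delta>_def M_def)
  also have "\<dots> = (\<Sum>i<n. (M * U) $$ (i, 0) * cofactor (M * U) i 0)"
    using Suc by (intro laplace_expansion_column[OF MU]) simp
  also have "\<dots> = (\<Sum>i<n. if i = l then (- 1) ^ l * a n * cofactor (M * U) l 0 else 0)"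
    by (rule sum.cong) (auto simp: col0)
  also have "\<dots> = (- 1) ^ l * a n * cofactor (M * U) l 0"
    using Suc by simp
  also have "\<dots> = a n"
    using detD by (simp add: cofactor_def D_def flip: power_add mult_2)
  finally show ?thesis .
qed

text \<open>
  Since \<open>g\<close> is a series in \<open>x ^ p\<close>, the coefficient of \<open>x ^ (p * k)\<close> in \<open>g * inverse g = 1\<close>
  involves only coefficients at multiples of \<open>p\<close>; this is the convolution identity for
  the subsequences.  The factor \<open>\<sigma>\<close> rescales the variable, so that one statement covers both
  sign conventions.
\<close>

lemma Delta_inverse_section:
  fixes g :: "rat fps" and \<sigma> :: rat
  assumes p: "p > 0" and g0: "fps_nth g 0 = 1"
    and supp: "\<And>k. \<not> p dvd k \<Longrightarrow> fps_nth g k = 0"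
  shows "\<Delta> n (\<lambda>k. (- \<sigma>) ^ k * fps_nth (inverse g) (p * k)) = \<sigma> ^ n * fps_nth g (p * n)"
proof (rule Delta_eq_of_convolution)
  fix k :: nat assume k: "k \<ge> 1"
  have "0 = fps_nth (g * inverse g) (p * k)"
    using k p g0 by (simp add: inverse_mult_eq_1')
  also have "\<dots> = (\<Sum>i\<le>p * k. fps_nth g i * fps_nth (inverse g) (p * k - i))"
    by (simp add: fps_mult_nth atLeast0AtMost)
  also have "\<dots> = (\<Sum>i \<in> (*) p ` {..k}. fps_nth g i * fps_nth (inverse g) (p * k - i))"
    using p by (intro sum.mono_neutral_right) (auto intro!: supp elim!: dvdE)
  also have "\<dots> = (\<Sum>j\<le>k. fps_nth g (p * j) * fps_nth (inverse g) (p * (k - j)))"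
    using p by (subst sum.reindex) (auto simp: inj_on_def diff_mult_distrib2)
  finally have *: "(\<Sum>j\<le>k. fps_nth g (p * j) * fps_nth (inverse g) (p * (k - j))) = 0"
    by simp
  have "(\<Sum>j\<le>k. (- 1) ^ j * (\<sigma> ^ j * fps_nth g (p * j)) *
            ((- \<sigma>) ^ (k - j) * fps_nth (inverse g) (p * (k - j)))) =
        (\<Sum>j\<le>k. (- \<sigma>) ^ k * (fps_nth g (p * j) * fps_nth (inverse g) (p * (k - j))))"
  proof (rule sum.cong)
    fix j assume "j \<in> {..k}"
    then have "(- \<sigma>) ^ k = (- \<sigma>) ^ j * (- \<sigma>) ^ (k - j)"
      by (simp flip: power_add)
    moreover have "(- \<sigma>) ^ j = (- 1) ^ j * \<sigma> ^ j"
      by (simp flip: power_mult_distrib)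
    ultimately show "(- 1) ^ j * (\<sigma> ^ j * fps_nth g (p * j)) *
            ((- \<sigma>) ^ (k - j) * fps_nth (inverse g) (p * (k - j))) =
        (- \<sigma>) ^ k * (fps_nth g (p * j) * fps_nth (inverse g) (p * (k - j)))"
      by simp
  qed simp
  also have "\<dots> = 0"
    by (simp add: * flip: sum_distrib_left)
  finally show "(\<Sum>j\<le>k. (- 1) ^ j * (\<sigma> ^ j * fps_nth g (p * j)) *
            ((- \<sigma>) ^ (k - j) * fps_nth (inverse g) (p * (k - j)))) = 0" .
qed (use g0 in simp_all)

section \<open>Coefficients of the truncated series\<close>

lemma nth_sum_const_X_power:
  fixes c :: "nat \<Rightarrow> rat"
  assumes "p > 0"
  shows "fps_nth (\<Sum>n=0..m. fps_const (c n) * fps_X ^ (p * n)) k =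
    (if p dvd k \<and> k div p \<le> m then c (k div p) else 0)"
proof -
  have "fps_nth (\<Sum>n=0..m. fps_const (c n) * fps_X ^ (p * n)) k =
      (\<Sum>n=0..m. if n = k div p then (if p dvd k then c n else 0) else 0)"
    unfolding fps_sum_nth using assms by (intro sum.cong) auto
  then show ?thesis by simp
qed

lemma pochhammer_Suc_eq_fact_quotient:
  "pochhammer (of_nat N + 1 :: rat) k = fact (N + k) / fact N"
proof (induction k)
  case (Suc k)
  have "pochhammer (of_nat N + 1 :: rat) (Suc k) = fact (N + k) / fact N * of_nat (Suc (N + k))"
    by (simp only: pochhammer_Suc Suc) simp
  then show ?case by (simp add: mult.commute)
qed simp

lemma pochhammer_double_plus_1:
  "pochhammer (2 * of_nat N + 1 :: rat) k = fact (2 * N + k) / fact (2 * N)"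
  using pochhammer_Suc_eq_fact_quotient[of "2 * N" k] by simp

lemma pochhammer_double_plus_2:
  "pochhammer (2 * of_nat N + 2 :: rat) k = fact (2 * N + 1 + k) / fact (2 * N + 1)"
  using pochhammer_Suc_eq_fact_quotient[of "2 * N + 1" k] by (simp add: add.commute)

section \<open>The four families\<close>

text \<open>
  The sign in \<open>\<xi>\<close> decides the value of \<open>\<sigma>\<close>: the factor \<open>(- 1) ^ k\<close> corresponds to \<open>\<sigma> = 1\<close>,
  and in the Cauchy family \<open>\<sigma> = - 1\<close> turns \<open>(- x) ^ n\<close> into a positive coefficient.
\<close>

lemma Delta_Bernoulli:
  assumes "m \<ge> 1" "n \<ge> 1"
  shows "\<Delta> n (\<lambda>k. A_le Bernoulli N m k / \<xi> Bernoulli k) = (if n \<le> m then \<alpha> Bernoulli N n else 0)"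
    and "\<Delta> n (\<lambda>k. A_ge Bernoulli N m k / \<xi> Bernoulli k) = (if n < m then 0 else \<alpha> Bernoulli N n)"
proof -
  define g :: "rat fps"
    where "g = (\<Sum>n=0..m. fps_const (1 / pochhammer (of_nat N + 1) n) * fps_X ^ n)"
  define h :: "rat fps"
    where "h = 1 + Abs_fps (\<lambda>n. if m \<le> n then 1 / pochhammer (of_nat N + 1) n else 0)"
  have nth_g: "fps_nth g k = (if k \<le> m then 1 / pochhammer (of_nat N + 1) k else 0)" for k
    using nth_sum_const_X_power[of 1 "\<lambda>n. 1 / pochhammer (of_nat N + 1) n" m k]
    by (simp add: g_def)
  have "(\<lambda>k. A_le Bernoulli N m k / \<xi> Bernoulli k) =
      (\<lambda>k. (- 1) ^ k * fps_nth (inverse g) (1 * k))"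
    by (simp add: fun_eq_iff bernoulli_le_def egf_coeff_def g_def field_simps
        flip: power_add mult_2)
  with Delta_inverse_section[of 1 g n 1]
  show "\<Delta> n (\<lambda>k. A_le Bernoulli N m k / \<xi> Bernoulli k) = (if n \<le> m then \<alpha> Bernoulli N n else 0)"
    by (simp add: nth_g pochhammer_Suc_eq_fact_quotient)
  have "(\<lambda>k. A_ge Bernoulli N m k / \<xi> Bernoulli k) =
      (\<lambda>k. (- 1) ^ k * fps_nth (inverse h) (1 * k))"
    by (simp add: fun_eq_iff bernoulli_ge_def egf_coeff_def h_def field_simps
        flip: power_add mult_2)
  with Delta_inverse_section[of 1 h n 1] assms
  show "\<Delta> n (\<lambda>k. A_ge Bernoulli N m k / \<xi> Bernoulli k) = (if n < m then 0 else \<alpha> Bernoulli N n)"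
    by (simp add: h_def pochhammer_Suc_eq_fact_quotient)
qed

lemma Delta_Cauchy:
  assumes "N \<ge> 1" "m \<ge> 1" "n \<ge> 1"
  shows "\<Delta> n (\<lambda>k. A_le Cauchy N m k / \<xi> Cauchy k) = (if n \<le> m then \<alpha> Cauchy N n else 0)"
    and "\<Delta> n (\<lambda>k. A_ge Cauchy N m k / \<xi> Cauchy k) = (if n < m then 0 else \<alpha> Cauchy N n)"
proof -
  define g :: "rat fps" where "g = fps_const (of_nat N) *
    (\<Sum>n=0..m. fps_const (1 / of_nat (N + n)) * (- fps_X) ^ n)"
  define h :: "rat fps" where "h = 1 + fps_const (of_nat N) *
    Abs_fps (\<lambda>n. if m \<le> n then (- 1) ^ n / of_nat (N + n) else 0)"
  have "fps_const (1 / of_nat (N + n)) * (- fps_X) ^ n =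
      fps_const ((- 1) ^ n / of_nat (N + n)) * (fps_X ^ (1 * n) :: rat fps)" for n
  proof -
    have "(- fps_X) ^ n = fps_const ((- 1) ^ n) * (fps_X ^ n :: rat fps)"
      by (subst power_minus) (simp flip: fps_const_power fps_const_neg)
    then show ?thesis by (simp flip: mult.assoc)
  qed
  then have nth_g: "fps_nth g k = (if k \<le> m then of_nat N * (- 1) ^ k / of_nat (N + k) else 0)" for k
    using nth_sum_const_X_power[of 1 "\<lambda>n. (- 1) ^ n / of_nat (N + n)" m k]
    by (simp add: g_def)
  have "(\<lambda>k. A_le Cauchy N m k / \<xi> Cauchy k) =
      (\<lambda>k. (- (- 1)) ^ k * fps_nth (inverse g) (1 * k))"
    by (simp add: fun_eq_iff cauchy_le_def egf_coeff_def g_def)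
  with Delta_inverse_section[of 1 g n "- 1"] assms
  show "\<Delta> n (\<lambda>k. A_le Cauchy N m k / \<xi> Cauchy k) = (if n \<le> m then \<alpha> Cauchy N n else 0)"
    by (simp add: nth_g flip: power_add mult_2)
  have "(\<lambda>k. A_ge Cauchy N m k / \<xi> Cauchy k) =
      (\<lambda>k. (- (- 1)) ^ k * fps_nth (inverse h) (1 * k))"
    by (simp add: fun_eq_iff cauchy_ge_def egf_coeff_def h_def)
  with Delta_inverse_section[of 1 h n "- 1"] assms
  show "\<Delta> n (\<lambda>k. A_ge Cauchy N m k / \<xi> Cauchy k) = (if n < m then 0 else \<alpha> Cauchy N n)"
    by (simp add: h_def flip: power_add mult_2)
qed

text \<open>Both Euler families are series in \<open>x ^ 2\<close> of the same shape and differ only in \<open>c\<close>.\<close>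

lemma Delta_even_truncations:
  fixes c :: "nat \<Rightarrow> rat"
  assumes "c 0 = 1" "m \<ge> 1" "n \<ge> 1"
  shows "\<Delta> n (\<lambda>k. egf_coeff (inverse (\<Sum>n=0..m. fps_const (c (2 * n)) * fps_X ^ (2 * n))) (2 * k)
            / ((- 1) ^ k * fact (2 * k))) = (if n \<le> m then c (2 * n) else 0)"
    and "\<Delta> n (\<lambda>k. egf_coeff (inverse (1 + Abs_fps (\<lambda>k. if even k \<and> 2 * m \<le> k then c k else 0))) (2 * k)
            / ((- 1) ^ k * fact (2 * k))) = (if n < m then 0 else c (2 * n))"
proof -
  have eq: "(\<lambda>k. egf_coeff f (2 * k) / ((- 1) ^ k * fact (2 * k))) =
      (\<lambda>k. (- 1) ^ k * fps_nth f (2 * k))" for f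
    by (auto simp: fun_eq_iff egf_coeff_def field_simps simp flip: power_add mult_2)
  note sect = Delta_inverse_section[of 2 _ n 1]
  show "\<Delta> n (\<lambda>k. egf_coeff (inverse (\<Sum>n=0..m. fps_const (c (2 * n)) * fps_X ^ (2 * n))) (2 * k)
            / ((- 1) ^ k * fact (2 * k))) = (if n \<le> m then c (2 * n) else 0)"
    unfolding eq using assms
    by (subst sect) (simp_all add: nth_sum_const_X_power[of 2 "\<lambda>n. c (2 * n)" m])
  show "\<Delta> n (\<lambda>k. egf_coeff (inverse (1 + Abs_fps (\<lambda>k. if even k \<and> 2 * m \<le> k then c k else 0))) (2 * k)
            / ((- 1) ^ k * fact (2 * k))) = (if n < m then 0 else c (2 * n))"
    unfolding eq using assms by (subst sect) (auto intro: Nat.gr0I)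
qed

theorem proposition9:
  fixes F :: family and N m n :: nat
  assumes "admissible F N" and "m \<ge> 1" and "n \<ge> 1"
  shows "\<Delta> n (\<lambda>k. A_le F N m k / \<xi> F k) = (if n \<le> m then \<alpha> F N n else 0)
       \<and> \<Delta> n (\<lambda>k. A_ge F N m k / \<xi> F k) = (if n < m then 0 else \<alpha> F N n)"
proof (cases F)
  case Bernoulli
  then show ?thesis using Delta_Bernoulli[OF assms(2,3)] by simp
next
  case Cauchy
  then show ?thesis using Delta_Cauchy[OF _ assms(2,3)] assms(1) by simp
next
  case Euler
  then show ?thesis
    using Delta_even_truncations[OF _ assms(2,3), of "\<lambda>k. 1 / pochhammer (2 * of_nat N + 1) k"]
    by (simp add: euler_le_def euler_ge_def pochhammer_double_plus_1)
next
  case Euler2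
  then show ?thesis
    using Delta_even_truncations[OF _ assms(2,3), of "\<lambda>k. 1 / pochhammer (2 * of_nat N + 2) k"]
    by (simp add: euler2_le_def euler2_ge_def pochhammer_double_plus_2)
qed

end
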